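(* Let $\mathcal{G}$ be a set of $n$-qubit Pauli strings, $\mathfrak{g}=\langle i\mathcal{G}\rangle_{\rm Lie}$, and $G=\exp\mathfrak g$ the corresponding compact Lie group with Haar probability measure $\mu_G$. Let $V$ and $W$ be Pauli strings belonging respectively to the connected components $C(V)$ and $C(W)$ of the commutator graph of $\mathcal{G}$. Then $$\mathbb{E}_{U\sim\mu_G} F(W,U^\dagger VU) = 1 - \frac{2\,|\{T\in C(V) : \{W,T\}=0 \}|}{|C(V)|}= 1 - \frac{2\,|\{T\in C(W) : \{V,T\}=0 \}| }{|C(W)|},$$ where $F(A,B)=\frac1d\mathrm{tr}[A^\dagger B^\dagger AB]$ is the out-of-time-order correlator and $\{A,B\}=AB+BA$ is the anticommutator.
   Context: $\mathcal H=(\mathbb C^2)^{\otimes n}$, $d=2^n$. A Pauli string is an operator $\sigma_1\otimes\cdots\otimes\sigma_n$ with each $\sigma_i\in\{I,X,Y,Z\}$. $\langle i\mathcal{G}\rangle_{\rm Lie}$ is the smallest real Lie algebra (under the matrix commutator) containing $\{ip:p\in\mathcal G\}$. The commutator graph of $\mathcal{G}$ is the undirected graph whose vertices are all $4^n$ Pauli strings, with an edge between $p$ and $q$ iff there is $g\in\mathcal{G}$ such that $[g,p]$ is a nonzero scalar multiple of $q$. *)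

theory Defs
  imports "HOL-Probability.Probability"
begin

text \<open>
  The qubits are indexed by a finite type \<open>'n\<close>, so \<open>n = CARD('n)\<close>. The computational basis of the
  n-fold tensor power of the space \<open>complex ^ 2\<close> is indexed by the functions \<open>'n \<Rightarrow> 2\<close>, and
  operators are matrices over this index type. The operator product is always \<open>**\<close>; the library's
  \<open>*\<close>, \<open>1\<close> and \<open>^\<close> on vectors are componentwise and do not occur.
\<close>

type_synonym 'n op = "complex ^ ('n \<Rightarrow> 2) ^ ('n \<Rightarrow> 2)"

definition tensor :: "('n::finite \<Rightarrow> complex^2^2) \<Rightarrow> 'n op" where
  "tensor S = (\<chi> x y. \<Prod>j\<in>UNIV. S j $ x j $ y j)"

definition dagger :: "complex^'m^'m \<Rightarrow> complex^'m^'m" where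
  "dagger A = (\<chi> i j. cnj (A $ j $ i))"

definition cscale :: "complex \<Rightarrow> complex^'m^'m \<Rightarrow> complex^'m^'m" where
  "cscale c A = (\<chi> i j. c * A $ i $ j)"

definition commutator :: "complex^'m::finite^'m \<Rightarrow> complex^'m^'m \<Rightarrow> complex^'m^'m" where
  "commutator A B = A ** B - B ** A"

definition anticommutator :: "complex^'m::finite^'m \<Rightarrow> complex^'m^'m \<Rightarrow> complex^'m^'m" where
  "anticommutator A B = A ** B + B ** A"

definition pauli_X :: "complex^2^2" where
  "pauli_X = vector [vector [0, 1], vector [1, 0]]"

definition pauli_Y :: "complex^2^2" where
  "pauli_Y = vector [vector [0, - \<i>], vector [\<i>, 0]]"

definition pauli_Z :: "complex^2^2" where
  "pauli_Z = vector [vector [1, 0], vector [0, - 1]]"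

definition pauli_strings :: "'n::finite op set" where
  "pauli_strings = {tensor S |S. \<forall>j. S j \<in> {mat 1, pauli_X, pauli_Y, pauli_Z}}"

definition is_real_Lie_algebra :: "(complex^'m::finite^'m) set \<Rightarrow> bool" where
  "is_real_Lie_algebra L \<longleftrightarrow> subspace L \<and> (\<forall>A\<in>L. \<forall>B\<in>L. commutator A B \<in> L)"

definition dla :: "'n::finite op set \<Rightarrow> 'n op set" where
  "dla \<G> = is_real_Lie_algebra hull (cscale \<i> ` \<G>)"

definition matrix_exp :: "complex^'m::finite^'m \<Rightarrow> complex^'m^'m" where
  "matrix_exp A = (\<Sum>k. (1 / fact k) *\<^sub>R (((**) A ^^ k) (mat 1)))"

text \<open>
  The Lie algebra of a set of Pauli strings is spanned by anti-Hermitian operators that are multiples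
  of Pauli strings; the exponential image below is then the whole compact connected group.
\<close>

definition dla_group :: "'n::finite op set \<Rightarrow> 'n op set" where
  "dla_group \<G> = matrix_exp ` dla \<G>"

text \<open>
  Haar probability measures of a compact matrix group \<open>G\<close>: Borel probability measures on \<open>G\<close>
  invariant under left translations.
\<close>

definition haar_prob_measure :: "(complex^'m::finite^'m) set \<Rightarrow> (complex^'m^'m) measure \<Rightarrow> bool" where
  "haar_prob_measure G \<mu> \<longleftrightarrow>
     prob_space \<mu> \<and> space \<mu> = G \<and> sets \<mu> = sets (restrict_space borel G) \<and>
     (\<forall>U\<in>G. \<forall>S\<in>sets \<mu>. emeasure \<mu> ((**) U ` S) = emeasure \<mu> S)"

definition commutator_edge :: "'n::finite op set \<Rightarrow> 'n op \<Rightarrow> 'n op \<Rightarrow> bool" where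
  "commutator_edge \<G> p q \<longleftrightarrow>
     p \<in> pauli_strings \<and> q \<in> pauli_strings \<and>
     (\<exists>g\<in>\<G>. \<exists>c. c \<noteq> 0 \<and> commutator g p = cscale c q)"

text \<open>\<open>equivclp\<close> is reachability along edges taken in either direction: the graph is undirected.\<close>

definition graph_component :: "'n::finite op set \<Rightarrow> 'n op \<Rightarrow> 'n op set" where
  "graph_component \<G> p = {q \<in> pauli_strings. equivclp (commutator_edge \<G>) p q}"

definition otoc :: "'n::finite op \<Rightarrow> 'n op \<Rightarrow> complex" where
  "otoc A B = 1 / 2 ^ CARD('n) * trace (dagger A ** dagger B ** A ** B)"

end

theory Submission
  imports Defs
begin

text \<open>
  Let \<open>C\<close> be a component of the commutator graph. The symmetric tensor \<open>\<Sum>T\<in>C. T \<otimes> T\<close> commutes with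
  \<open>A \<otimes> 1 + 1 \<otimes> A\<close> for every \<open>A\<close> in the Lie algebra, hence is invariant under conjugation by
  \<open>U \<otimes> U\<close>; it is represented here by the map \<open>X \<mapsto> \<Sum>T\<in>C. T X T\<close>. Therefore the sum of
  \<open>F(W, U\<^sup>\<dagger>TU)\<close> over \<open>T \<in> C(V)\<close> does not depend on \<open>U\<close> and equals its value at \<open>U = 1\<close>, where each
  term is \<open>1\<close> or \<open>-1\<close>. On the other hand, all these terms have the same average over the group:
  conjugation by \<open>exp (i\<pi>g/4)\<close> carries a Pauli string to its neighbour along \<open>g\<close>, up to a sign
  that \<open>F\<close> ignores, and left invariance of the measure suffices. The second formula follows by
  counting the anticommuting pairs in \<open>C(V) \<times> C(W)\<close> in two ways.
\<close>

subsection \<open>Matrix algebra\<close>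


lemma bilinear_matrix_mul: "bilinear ((**) :: complex^'m::finite^'m \<Rightarrow> complex^'m^'m \<Rightarrow> complex^'m^'m)"
  unfolding bilinear_def linear_iff
  by (auto simp: vec_eq_iff matrix_matrix_mult_def sum.distrib algebra_simps scaleR_sum_right)

text \<open>Supplies distributivity over sums, continuity and the product rule for derivatives of
  \<open>**\<close>.\<close>

interpretation matrix_mul: bounded_bilinear "(**) :: complex^'m::finite^'m \<Rightarrow> complex^'m^'m \<Rightarrow> complex^'m^'m"
  using bilinear_matrix_mul bilinear_conv_bounded_bilinear by blast

lemma cscale_mul_left: "cscale c A ** B = cscale c (A ** B)"
  by (simp add: cscale_def vec_eq_iff matrix_matrix_mult_def sum_distrib_left mult_ac)

lemma cscale_mul_right: "A ** cscale c B = cscale c (A ** B)"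
  by (simp add: cscale_def vec_eq_iff matrix_matrix_mult_def sum_distrib_left mult_ac)

lemma cscale_cscale [simp]: "cscale a (cscale b A) = cscale (a * b) A"
  by (simp add: cscale_def vec_eq_iff)

lemma cscale_1 [simp]: "cscale 1 A = A"
  by (simp add: cscale_def vec_eq_iff)

lemma cscale_0 [simp]: "cscale 0 A = 0"
  by (simp add: cscale_def vec_eq_iff)

lemma cscale_minus1: "cscale (- 1) A = - A"
  by (simp add: cscale_def vec_eq_iff)

lemma linear_cscale: "linear (cscale c :: complex^'m^'m \<Rightarrow> complex^'m^'m)"
  by (simp add: linear_iff cscale_def vec_eq_iff algebra_simps)

lemma cscale_diff: "cscale c (A - B) = cscale c A - cscale c B"
  by (simp add: cscale_def vec_eq_iff algebra_simps)

lemma cscale_minus: "cscale c (- A) = cscale (- c) A"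
  by (simp add: cscale_def vec_eq_iff)

lemma trace_cscale: "trace (cscale c A) = c * trace A"
  by (simp add: trace_def cscale_def sum_distrib_left)

lemma linear_trace: "linear (trace :: complex^'m^'m \<Rightarrow> complex)"
  by (simp add: linear_iff trace_def sum.distrib scaleR_sum_right)

lemma linear_dagger: "linear (dagger :: complex^'m^'m \<Rightarrow> complex^'m^'m)"
  by (simp add: linear_iff dagger_def vec_eq_iff)

lemma dagger_mul: "dagger (A ** B) = dagger B ** dagger A"
  by (simp add: dagger_def vec_eq_iff matrix_matrix_mult_def mult_ac)

lemma dagger_cscale: "dagger (cscale c A) = cscale (cnj c) (dagger A)"
  by (simp add: dagger_def cscale_def vec_eq_iff)

lemma dagger_mat_1 [simp]: "dagger (mat 1) = mat 1"
  by (simp add: dagger_def mat_def vec_eq_iff)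

lemmas matrix_mul_distribs =
  matrix_mul.add_left matrix_mul.add_right matrix_mul.diff_left matrix_mul.diff_right
  matrix_mul.minus_left matrix_mul.minus_right

lemma commutator_cscale_left: "commutator (cscale c A) B = cscale c (commutator A B)"
  by (simp add: commutator_def cscale_mul_left cscale_mul_right cscale_diff)

subsection \<open>The matrix exponential\<close>

text \<open>Limits in \<open>'b^'m\<close> are taken entrywise; two applications reduce the
  derivative of a matrix-valued curve to those of its entries.\<close>

lemma has_vector_derivative_vecI:
  fixes f :: "real \<Rightarrow> 'b::real_normed_vector^'m"
  assumes "\<And>i. ((\<lambda>t. f t $ i) has_vector_derivative D $ i) (at t)"
  shows "(f has_vector_derivative D) (at t)"
  using assms unfolding has_vector_derivative_def has_derivative_def
  by (auto intro!: vec_tendstoI bounded_linear_scaleR_left)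

abbreviation matrix_power :: "complex^'m::finite^'m \<Rightarrow> nat \<Rightarrow> complex^'m^'m" where
  "matrix_power A k \<equiv> ((**) A ^^ k) (mat 1)"

lemma matrix_power_commute: "matrix_power A k ** A = A ** matrix_power A k"
  by (induction k) (simp_all flip: matrix_mul_assoc)

lemma matrix_power_scaleR: "matrix_power (t *\<^sub>R A) k = t ^ k *\<^sub>R matrix_power A k"
  by (induction k) (simp_all add: matrix_mul.scaleR_left matrix_mul.scaleR_right)

lemma summable_matrix_exp:
  fixes A :: "complex^'m::finite^'m"
  shows "summable (\<lambda>k. (1 / fact k) *\<^sub>R matrix_power A k)"
proof -
  \<comment> \<open>Any constant bounding the bilinear map will do: it is absorbed into the base of
    the dominating exponential series.\<close>
  obtain K where K: "K > 0" "\<And>A B. norm ((A :: complex^'m^'m) ** (B :: complex^'m^'m)) \<le> norm A * norm B * K"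
    using matrix_mul.pos_bounded by metis
  have bound: "norm (matrix_power A k) \<le> norm (mat 1 :: complex^'m^'m) * (norm A * K) ^ k" for k
  proof (induction k)
    case (Suc k)
    have "norm (matrix_power A (Suc k)) \<le> norm A * norm (matrix_power A k) * K"
      using K(2) by simp
    also have "\<dots> \<le> norm A * (norm (mat 1 :: complex^'m^'m) * (norm A * K) ^ k) * K"
      using Suc K(1) by (intro mult_right_mono mult_left_mono) auto
    finally show ?case by (simp add: mult_ac)
  qed simp
  have "summable (\<lambda>k. norm (mat 1 :: complex^'m^'m) * (inverse (fact k) * (norm A * K) ^ k))"
    by (intro summable_mult summable_exp)
  then show ?thesis
  proof (rule summable_comparison_test')
    fix k :: nat
    show "norm ((1 / fact k) *\<^sub>R matrix_power A k)
        \<le> norm (mat 1 :: complex^'m^'m) * (inverse (fact k) * (norm A * K) ^ k)"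
      using mult_left_mono[OF bound[of k], of "inverse (fact k)"]
      by (simp add: divide_inverse mult_ac)
  qed
qed

lemma matrix_exp_commute: "matrix_exp A ** A = A ** matrix_exp A"
  unfolding matrix_exp_def
  using bounded_linear.suminf[OF matrix_mul.bounded_linear_left summable_matrix_exp, of A A]
    bounded_linear.suminf[OF matrix_mul.bounded_linear_right summable_matrix_exp, of A A]
  by (simp add: matrix_mul.scaleR_left matrix_mul.scaleR_right matrix_power_commute)

lemma matrix_exp_0 [simp]: "matrix_exp 0 = mat 1"
proof -
  have "matrix_power (0 :: complex^'m^'m) k = 0" if "k \<notin> {0}" for k
    using that by (cases k) simp_all
  then have "matrix_exp (0 :: complex^'m^'m)
      = (\<Sum>k\<in>{0}. (1 / fact k) *\<^sub>R matrix_power (0 :: complex^'m^'m) k)"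
    unfolding matrix_exp_def by (intro suminf_finite) auto
  then show ?thesis by simp
qed

text \<open>The factor \<open>B\<close> lets one expansion serve twice: \<open>B = mat 1\<close>
  gives the entries of the exponential, \<open>B = A\<close> those of its derivative.\<close>

lemma matrix_exp_entry_sums:
  fixes A B :: "complex^'m::finite^'m"
  shows "(\<lambda>k. (1 / fact k) *\<^sub>R (B ** matrix_power A k) $ i $ j) sums (B ** matrix_exp A) $ i $ j"
proof -
  have "bounded_linear (\<lambda>X. (B ** X) $ i $ j)"
    by (intro bounded_linear_compose[OF bounded_linear_vec_nth] matrix_mul.bounded_linear_right)
  from bounded_linear.sums[OF this summable_sums[OF summable_matrix_exp[of A]]]
  show ?thesis
    by (simp add: matrix_exp_def matrix_mul.scaleR_right)
qed

lemma matrix_exp_has_vector_derivative: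
  "((\<lambda>t. matrix_exp (t *\<^sub>R A)) has_vector_derivative A ** matrix_exp (t *\<^sub>R A)) (at t)"
proof (intro has_vector_derivative_vecI)
  fix i j
  define c :: "nat \<Rightarrow> complex" where "c = (\<lambda>k. (1 / fact k) * matrix_power A k $ i $ j)"
  have exp_sums: "(\<lambda>k. c k * of_real s ^ k) sums matrix_exp (s *\<^sub>R A) $ i $ j" for s
    using matrix_exp_entry_sums[of "mat 1" "s *\<^sub>R A" i j]
    by (simp add: c_def matrix_power_scaleR scaleR_conv_of_real[where 'a=complex] mult_ac)
  \<comment> \<open>Formal differentiation cancels one factor of the factorial and leaves one
    additional factor \<open>A\<close>.\<close>
  have diffs: "diffs c k = (1 / fact k) * (A ** matrix_power A k) $ i $ j" for k
    by (simp add: diffs_def c_def field_simps del: of_nat_Suc)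
  have "(\<lambda>k. diffs c k * of_real t ^ k) sums (A ** matrix_exp (t *\<^sub>R A)) $ i $ j"
    using matrix_exp_entry_sums[of A "t *\<^sub>R A" i j]
    by (simp add: diffs matrix_power_scaleR matrix_mul.scaleR_right scaleR_conv_of_real[where 'a=complex] mult_ac)
  then have deriv_eq: "(\<Sum>k. diffs c k * of_real t ^ k) = (A ** matrix_exp (t *\<^sub>R A)) $ i $ j"
    by (simp add: sums_iff)
  \<comment> \<open>Convergence at the larger real point \<open>norm z + 1\<close> gives convergence
    at every complex \<open>z\<close>, as termwise differentiation requires.\<close>
  have "summable (\<lambda>k. c k * z ^ k)" for z
  proof (rule powser_inside)
    show "summable (\<lambda>k. c k * of_real (norm z + 1) ^ k)"
      using exp_sums[of "norm z + 1"] by (simp add: sums_iff)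
    show "norm z < norm (of_real (norm z + 1) :: complex)"
      by (simp only: norm_of_real)
  qed
  from termdiffs_strong_converges_everywhere[OF this, of "of_real t"]
  have "((\<lambda>s. \<Sum>k. c k * of_real s ^ k) has_vector_derivative
      (A ** matrix_exp (t *\<^sub>R A)) $ i $ j) (at t)"
    unfolding deriv_eq[symmetric] by (rule has_vector_derivative_real_field)
  then show "((\<lambda>s. matrix_exp (s *\<^sub>R A) $ i $ j) has_vector_derivative
      (A ** matrix_exp (t *\<^sub>R A)) $ i $ j) (at t)"
    using exp_sums by (simp add: sums_iff)
qed


section \<open>Exponential identities from curves with vanishing derivative\<close>

lemma zero_derivative_imp_eq:
  fixes f :: "real \<Rightarrow> 'b::real_normed_vector"
  assumes "\<And>t. (f has_vector_derivative 0) (at t)"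
  shows "f a = f b"
  using has_vector_derivative_zero_constant[of UNIV f] assms by (metis UNIV_I convex_UNIV)

lemma matrix_exp_scaleR_commute: "matrix_exp (t *\<^sub>R A) ** A = A ** matrix_exp (t *\<^sub>R A)"
  by (cases "t = 0")
    (use matrix_exp_commute[of "t *\<^sub>R A"] in
      \<open>simp_all add: matrix_mul.scaleR_left matrix_mul.scaleR_right\<close>)

text \<open>The factor \<open>- A\<close> stands on the right so that in a product it meets the
  derivative of the next factor and cancels against it.\<close>

lemma matrix_exp_minus_has_vector_derivative:
  "((\<lambda>t. matrix_exp (t *\<^sub>R (- A))) has_vector_derivative matrix_exp (t *\<^sub>R (- A)) ** (- A)) (at t)"
  unfolding matrix_exp_scaleR_commute by (rule matrix_exp_has_vector_derivative)

lemma matrix_exp_minus_left: "matrix_exp (- A) ** matrix_exp A = mat 1"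
proof -
  have "((\<lambda>t. matrix_exp (t *\<^sub>R (- A)) ** matrix_exp (t *\<^sub>R A)) has_vector_derivative 0) (at t)" for t
    using matrix_mul.has_vector_derivative
      [OF matrix_exp_minus_has_vector_derivative[of A t] matrix_exp_has_vector_derivative[of A t]]
    by (simp add: matrix_mul_assoc matrix_mul.minus_left matrix_mul.minus_right)
  from zero_derivative_imp_eq[OF this, of 1 0] show ?thesis by simp
qed

lemma matrix_exp_minus_right: "matrix_exp A ** matrix_exp (- A) = mat 1"
  using matrix_exp_minus_left[of "- A"] by simp

text \<open>For anti-Hermitian \<open>A\<close> the curve \<open>dagger (?E t) ** ?E t\<close> is
  constant, so the adjoint is a left inverse of the exponential.\<close>

lemma dagger_matrix_exp:
  assumes "dagger A = - A"
  shows "dagger (matrix_exp A) = matrix_exp (- A)"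
proof -
  let ?E = "\<lambda>t. matrix_exp (t *\<^sub>R A)"
  have "((\<lambda>t. dagger (?E t) ** ?E t) has_vector_derivative 0) (at t)" for t
  proof -
    have "bounded_linear (dagger :: complex^'a^'a \<Rightarrow> _)"
      by (simp add: linear_dagger flip: linear_conv_bounded_linear)
    from bounded_linear.has_vector_derivative[OF this matrix_exp_has_vector_derivative[of A t]]
    have "((\<lambda>t. dagger (?E t)) has_vector_derivative dagger (A ** ?E t)) (at t)" .
    from matrix_mul.has_vector_derivative[OF this matrix_exp_has_vector_derivative[of A t]] show ?thesis
      by (simp add: dagger_mul assms matrix_mul_assoc matrix_mul.minus_left matrix_mul.minus_right)
  qed
  from zero_derivative_imp_eq[OF this, of 1 0]
  have "dagger (matrix_exp A) ** matrix_exp A = mat 1" by simp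
  then have "dagger (matrix_exp A) ** (matrix_exp A ** matrix_exp (- A)) = matrix_exp (- A)"
    by (simp add: matrix_mul_assoc)
  then show ?thesis by (simp add: matrix_exp_minus_right)
qed

text \<open>Pulling the left side back by the inverse conjugation gives a curve whose derivative
  vanishes, because \<open>\<Psi>\<close> commutes with \<open>commutator A\<close>. This is the
  passage from the Lie algebra to the group.\<close>

lemma linear_commute_Ad_exp:
  assumes lin: "linear \<Psi>" and ad: "\<And>X. \<Psi> (commutator A X) = commutator A (\<Psi> X)"
  shows "\<Psi> (matrix_exp A ** X ** matrix_exp (- A)) = matrix_exp A ** \<Psi> X ** matrix_exp (- A)"
proof -
  let ?E = "\<lambda>t. matrix_exp (t *\<^sub>R A)" and ?E' = "\<lambda>t. matrix_exp (t *\<^sub>R (- A))"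
  let ?Y = "\<lambda>t. ?E t ** X ** ?E' t"
  note rules = matrix_mul_assoc matrix_mul_distribs
  have "((\<lambda>t. ?E' t ** \<Psi> (?Y t) ** ?E t) has_vector_derivative 0) (at t)" for t
  proof -
    have E: "(?E has_vector_derivative A ** ?E t) (at t)"
      by (rule matrix_exp_has_vector_derivative)
    have E': "(?E' has_vector_derivative ?E' t ** (- A)) (at t)"
      by (rule matrix_exp_minus_has_vector_derivative)
    have "(?Y has_vector_derivative commutator A (?Y t)) (at t)"
      using matrix_mul.has_vector_derivative[OF matrix_mul.has_vector_derivative[OF E
          has_vector_derivative_const[of X]] E']
      by (simp add: commutator_def rules)
    moreover have "bounded_linear \<Psi>"
      using lin by (simp add: linear_conv_bounded_linear)
    ultimately have "((\<lambda>t. \<Psi> (?Y t)) has_vector_derivative commutator A (\<Psi> (?Y t))) (at t)"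
      unfolding ad[symmetric] using bounded_linear.has_vector_derivative by blast
    from matrix_mul.has_vector_derivative[OF matrix_mul.has_vector_derivative[OF E' this] E]
    show ?thesis
      by (simp add: commutator_def rules)
  qed
  from zero_derivative_imp_eq[OF this, of 1 0]
  have "matrix_exp (- A) ** \<Psi> (matrix_exp A ** X ** matrix_exp (- A)) ** matrix_exp A = \<Psi> X"
    by simp
  then have "matrix_exp A ** \<Psi> X ** matrix_exp (- A)
      = (matrix_exp A ** matrix_exp (- A)) ** \<Psi> (matrix_exp A ** X ** matrix_exp (- A))
        ** (matrix_exp A ** matrix_exp (- A))"
    by (metis matrix_mul_assoc)
  then show ?thesis by (simp add: matrix_exp_minus_right)
qed

text \<open>Euler's formula with \<open>B\<close> as imaginary unit: the right side multiplied by
  \<open>matrix_exp (t *\<^sub>R (- B))\<close> is a constant curve.\<close>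

lemma matrix_exp_complex_structure:
  fixes B :: "complex^'m::finite^'m"
  assumes "B ** B = - mat 1"
  shows "matrix_exp (t *\<^sub>R B) = cos t *\<^sub>R mat 1 + sin t *\<^sub>R B"
proof -
  let ?R = "\<lambda>t. cos t *\<^sub>R mat 1 + sin t *\<^sub>R B"
  let ?E' = "\<lambda>t. matrix_exp (t *\<^sub>R (- B))"
  have "((\<lambda>t. ?E' t ** ?R t) has_vector_derivative 0) (at s)" for s
  proof -
    have R: "(?R has_vector_derivative (- sin s) *\<^sub>R mat 1 + cos s *\<^sub>R B) (at s)"
      by (auto intro!: derivative_eq_intros)
    have E': "(?E' has_vector_derivative ?E' s ** (- B)) (at s)"
      by (rule matrix_exp_minus_has_vector_derivative)
    have BB: "X ** B ** B = - X" for X :: "complex^'m^'m"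
      using assms by (simp add: matrix_mul.minus_right flip: matrix_mul_assoc)
    from matrix_mul.has_vector_derivative[OF E' R] show ?thesis
      by (simp add: matrix_mul_assoc matrix_mul_distribs matrix_mul.scaleR_right BB)
  qed
  from zero_derivative_imp_eq[OF this, of t 0]
  have "matrix_exp (- (t *\<^sub>R B)) ** ?R t = mat 1" by simp
  then have "matrix_exp (t *\<^sub>R B) ** (matrix_exp (- (t *\<^sub>R B)) ** ?R t) = matrix_exp (t *\<^sub>R B)"
    by simp
  then show ?thesis
    by (simp add: matrix_mul_assoc matrix_exp_minus_right)
qed


subsection \<open>Pauli strings\<close>

abbreviation paulis :: "(complex^2^2) set" where
  "paulis \<equiv> {mat 1, pauli_X, pauli_Y, pauli_Z}"

text \<open>Basis states of the tensor power are functions on the qubits, so a sum over them of a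
  product over qubits factorises. Products and traces of tensors are thereby computed qubit by
  qubit.\<close>

lemma prod_sum_UNIV:
  fixes f :: "'n::finite \<Rightarrow> 'b::finite \<Rightarrow> complex"
  shows "(\<Prod>j\<in>UNIV. \<Sum>k\<in>UNIV. f j k) = (\<Sum>g\<in>UNIV. \<Prod>j\<in>UNIV. f j (g j))"
  using prod_sum_PiE[of UNIV "\<lambda>_. UNIV" f] by (simp add: PiE_def)

lemma tensor_mul: "tensor S ** tensor R = tensor (\<lambda>j. S j ** R j)"
  by (simp add: tensor_def vec_eq_iff matrix_matrix_mult_def prod_sum_UNIV prod.distrib)

lemma trace_tensor: "trace (tensor S) = (\<Prod>j\<in>UNIV. trace (S j))"
  by (simp add: tensor_def trace_def prod_sum_UNIV)

lemma tensor_cscale: "tensor (\<lambda>j. cscale (c j) (S j)) = cscale (\<Prod>j\<in>UNIV. c j) (tensor S)"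
  by (simp add: tensor_def cscale_def vec_eq_iff prod.distrib)

lemma dagger_tensor: "dagger (tensor S) = tensor (\<lambda>j. dagger (S j))"
  by (simp add: tensor_def dagger_def vec_eq_iff)

lemma tensor_mat_1: "tensor (\<lambda>_. mat 1) = (mat 1 :: 'n::finite op)"
proof -
  have "(\<Prod>j\<in>UNIV. mat 1 $ x j $ y j) = (mat 1 :: 'n op) $ x $ y" for x y
  proof (cases "x = y")
    case False
    then obtain j where "x j \<noteq> y j" by auto
    then have "(mat 1 :: complex^2^2) $ x j $ y j = 0" by (simp add: mat_def)
    with False show ?thesis by (auto simp: mat_def intro!: prod_zero)
  qed (simp add: mat_def)
  then show ?thesis by (simp add: tensor_def vec_eq_iff)
qed

section \<open>Single-qubit Pauli matrices\<close>

lemmas pauli_defs = pauli_X_def pauli_Y_def pauli_Z_def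

lemmas matrix_2_simps = vec_eq_iff forall_2 matrix_matrix_mult_def sum_2 mat_def cscale_def
  dagger_def trace_def

lemma pauli_mul:
  "pauli_X ** pauli_X = mat 1" "pauli_Y ** pauli_Y = mat 1" "pauli_Z ** pauli_Z = mat 1"
  "pauli_X ** pauli_Y = cscale \<i> pauli_Z" "pauli_Y ** pauli_X = cscale (- \<i>) pauli_Z"
  "pauli_Y ** pauli_Z = cscale \<i> pauli_X" "pauli_Z ** pauli_Y = cscale (- \<i>) pauli_X"
  "pauli_Z ** pauli_X = cscale \<i> pauli_Y" "pauli_X ** pauli_Z = cscale (- \<i>) pauli_Y"
  by (simp_all add: pauli_defs matrix_2_simps)

lemma pauli_trace:
  "trace pauli_X = 0" "trace pauli_Y = 0" "trace pauli_Z = 0"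
  by (simp_all add: pauli_defs matrix_2_simps)

lemma paulis_square: "P \<in> paulis \<Longrightarrow> P ** P = mat 1"
  by (auto simp: pauli_mul)

lemma paulis_dagger: "P \<in> paulis \<Longrightarrow> dagger P = P"
  by (auto simp: pauli_defs matrix_2_simps)

lemma paulis_mul:
  assumes "P \<in> paulis" "Q \<in> paulis"
  shows "\<exists>R\<in>paulis. \<exists>c. c \<noteq> 0 \<and> P ** Q = cscale c R"
proof -
  have "\<exists>R\<in>paulis. P ** Q \<in> {cscale 1 R, cscale \<i> R, cscale (- \<i>) R}"
    using assms by (elim insertE) (simp_all add: pauli_mul)
  moreover have "(1::complex) \<noteq> 0" "\<i> \<noteq> 0" "- \<i> \<noteq> 0" by simp_all
  ultimately show ?thesis by blast
qed

text \<open>The sign is recorded as \<open>e\<close> with square 1, a property that survives the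
  product over all qubits.\<close>

lemma paulis_commute:
  assumes "P \<in> paulis" "Q \<in> paulis"
  shows "\<exists>e. e\<^sup>2 = 1 \<and> P ** Q = cscale e (Q ** P)"
proof -
  have "P ** Q = cscale 1 (Q ** P) \<or> P ** Q = cscale (- 1) (Q ** P)"
    using assms by (elim insertE) (simp_all add: pauli_mul)
  then show ?thesis by (metis one_power2 power2_minus)
qed

lemma paulis_trace:
  assumes "P \<in> paulis" "Q \<in> paulis" "P \<noteq> Q"
  shows "trace (P ** Q) = 0"
  using assms by (elim insertE) (simp_all add: pauli_mul pauli_trace trace_cscale)

section \<open>Pauli strings on all qubits\<close>

lemma pauli_strings_cases:
  assumes "p \<in> pauli_strings"
  obtains S where "p = tensor S" "\<And>j. S j \<in> paulis"
  using assms unfolding pauli_strings_def by blast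

lemma finite_pauli_strings: "finite pauli_strings"
proof -
  have "pauli_strings \<subseteq> tensor ` PiE UNIV (\<lambda>_. paulis)"
    unfolding pauli_strings_def by (auto simp: PiE_def)
  moreover have "finite (PiE (UNIV :: 'a set) (\<lambda>_. paulis))"
    by (intro finite_PiE) auto
  ultimately show ?thesis using finite_surj by blast
qed

lemma pauli_string_square: "p \<in> pauli_strings \<Longrightarrow> p ** p = mat 1"
  by (elim pauli_strings_cases) (simp add: tensor_mul paulis_square tensor_mat_1)

lemma pauli_string_dagger: "p \<in> pauli_strings \<Longrightarrow> dagger p = p"
  by (elim pauli_strings_cases) (simp add: dagger_tensor paulis_dagger)

lemma pauli_string_mul:
  assumes "p \<in> pauli_strings" "q \<in> pauli_strings"
  shows "\<exists>r\<in>pauli_strings. \<exists>c. c \<noteq> 0 \<and> p ** q = cscale c r"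
proof -
  obtain S R where S: "p = tensor S" "\<And>j. S j \<in> paulis" and R: "q = tensor R" "\<And>j. R j \<in> paulis"
    using assms by (metis pauli_strings_cases)
  obtain T c where T: "\<And>j. T j \<in> paulis" "\<And>j. c j \<noteq> 0" "\<And>j. S j ** R j = cscale (c j) (T j)"
  proof -
    have "\<forall>j. \<exists>T c. T \<in> paulis \<and> c \<noteq> 0 \<and> S j ** R j = cscale c T"
      using paulis_mul[OF S(2) R(2)] by blast
    then show thesis using that by metis
  qed
  have "p ** q = cscale (\<Prod>j\<in>UNIV. c j) (tensor T)"
    by (simp add: S(1) R(1) tensor_mul T(3) tensor_cscale)
  moreover have "tensor T \<in> pauli_strings"
    using T(1) unfolding pauli_strings_def by blast
  moreover have "(\<Prod>j\<in>UNIV. c j) \<noteq> 0" using T(2) by simp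
  ultimately show ?thesis by blast
qed

lemma pauli_string_commute_cases:
  assumes "p \<in> pauli_strings" "q \<in> pauli_strings"
  shows "p ** q = q ** p \<or> p ** q = - (q ** p)"
proof -
  obtain S R where S: "p = tensor S" "\<And>j. S j \<in> paulis" and R: "q = tensor R" "\<And>j. R j \<in> paulis"
    using assms by (metis pauli_strings_cases)
  obtain e where e: "\<And>j. (e j)\<^sup>2 = 1" "\<And>j. S j ** R j = cscale (e j) (R j ** S j)"
  proof -
    have "\<forall>j. \<exists>e. e\<^sup>2 = 1 \<and> S j ** R j = cscale e (R j ** S j)"
      using paulis_commute[OF S(2) R(2)] by blast
    then show thesis using that by metis
  qed
  have "p ** q = cscale (\<Prod>j\<in>UNIV. e j) (q ** p)"
    by (simp add: S(1) R(1) tensor_mul e(2) tensor_cscale)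
  moreover have "(\<Prod>j\<in>UNIV. e j)\<^sup>2 = 1"
    by (simp add: e(1) prod_power_distrib)
  ultimately show ?thesis
    by (auto simp: power2_eq_1_iff cscale_minus1)
qed

text \<open>Orthogonality for the trace pairing: at a qubit where the strings differ, the product of
  the two factors is traceless, and the trace of a tensor is the product of the traces.\<close>

lemma trace_pauli_string_mul:
  fixes p q :: "'n::finite op"
  assumes "p \<in> pauli_strings" "q \<in> pauli_strings"
  shows "trace (p ** q) = (if p = q then 2 ^ CARD('n) else 0)"
proof (cases "p = q")
  case True
  have "CARD('n \<Rightarrow> 2) = 2 ^ CARD('n)"
    by (simp add: card_fun)
  with True assms show ?thesis
    by (simp add: pauli_string_square trace_I)
next
  case False
  obtain S R where S: "p = tensor S" "\<And>j. S j \<in> paulis" and R: "q = tensor R" "\<And>j. R j \<in> paulis"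
    using assms by (metis pauli_strings_cases)
  have "S \<noteq> R" using False S(1) R(1) by blast
  then obtain j where "S j \<noteq> R j" by blast
  then have "trace (S j ** R j) = 0" using paulis_trace S(2) R(2) by blast
  with False show ?thesis
    by (auto simp: S(1) R(1) tensor_mul trace_tensor intro!: prod_zero)
qed


subsection \<open>Components of the commutator graph\<close>

definition sandwich_sum :: "(complex^'m::finite^'m) set \<Rightarrow> complex^'m^'m \<Rightarrow> complex^'m^'m" where
  "sandwich_sum C X = (\<Sum>T\<in>C. T ** X ** T)"

lemma linear_sandwich_sum: "linear (sandwich_sum C)"
  unfolding linear_iff sandwich_sum_def
  by (simp add: matrix_mul_distribs matrix_mul.scaleR_left matrix_mul.scaleR_right
      sum.distrib scaleR_sum_right)

lemma sum_cscale: "cscale c (sum f C) = (\<Sum>x\<in>C. cscale c (f x))"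
  using linear_sum[OF linear_cscale] by blast

lemma sandwich_sum_cscale: "sandwich_sum C (cscale c X) = cscale c (sandwich_sum C X)"
  by (simp add: sandwich_sum_def cscale_mul_left cscale_mul_right sum_cscale)

text \<open>Cyclicity of the trace makes \<open>commutator g\<close> antisymmetric for the trace
  pairing.\<close>

lemma trace_commutator: "trace (commutator g A ** B) = - trace (A ** commutator g B)"
proof -
  have "trace (g ** A ** B) = trace (A ** B ** g)"
    using trace_mul_sym[of g "A ** B"] by (simp add: matrix_mul_assoc)
  then show ?thesis
    by (simp add: commutator_def matrix_mul_distribs matrix_mul_assoc trace_sub)
qed

section \<open>Edges of the commutator graph\<close>

lemma pauli_string_anticommuting_edge:
  assumes "g \<in> \<G>" "g \<in> pauli_strings" "p \<in> pauli_strings" "g ** p \<noteq> p ** g"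
  obtains q c where "commutator_edge \<G> p q" "commutator g p = cscale c q"
proof -
  obtain q c where q: "q \<in> pauli_strings" "c \<noteq> 0" "g ** p = cscale c q"
    using pauli_string_mul[OF assms(2,3)] by blast
  have "g ** p = - (p ** g)"
    using pauli_string_commute_cases[OF assms(2,3)] assms(4) by blast
  then have "commutator g p = g ** p + g ** p"
    by (simp add: commutator_def)
  also have "\<dots> = cscale (2 * c) q"
    by (simp add: q(3) cscale_def vec_eq_iff)
  finally have eq: "commutator g p = cscale (2 * c) q" .
  moreover have "commutator_edge \<G> p q"
    unfolding commutator_edge_def using assms q eq by (intro conjI bexI[of _ g] exI[of _ "2 * c"]) auto
  ultimately show thesis using that by blast
qed

text \<open>As \<open>g\<close> and \<open>p\<close> anticommute, their commutator is twice
  \<open>g ** p\<close>, which squares to \<open>- mat 1\<close>. Comparing with the square of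
  \<open>cscale c q\<close> fixes \<open>c\<close> up to sign.\<close>

lemma commutator_edgeE:
  fixes p q :: "'n::finite op"
  assumes "commutator_edge \<G> p q" "\<G> \<subseteq> pauli_strings"
  obtains g c where "g \<in> \<G>" "p \<in> pauli_strings" "q \<in> pauli_strings" "g ** p = - (p ** g)"
    "commutator g p = cscale c q" "c\<^sup>2 = - 4"
proof -
  obtain g c where g: "g \<in> \<G>" "c \<noteq> 0" "commutator g p = cscale c q"
    and p: "p \<in> pauli_strings" and q: "q \<in> pauli_strings"
    using assms(1) unfolding commutator_edge_def by blast
  have gg: "g ** g = mat 1" "p ** p = mat 1" "q ** q = mat 1"
    using g(1) p q assms(2) by (auto intro: pauli_string_square)
  have "commutator g p \<noteq> 0"
  proof
    assume "commutator g p = 0"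
    then have "cscale (1 / c) (cscale c q) = 0"
      by (simp add: g(3) linear_0[OF linear_cscale])
    then have "q ** q = 0" using g(2) by (simp add: matrix_mul.zero_left)
    then have "(mat 1 :: 'n op) $ x $ x = 0" for x unfolding gg(3) by simp
    then show False by (simp add: mat_def)
  qed
  then have anti: "g ** p = - (p ** g)"
    using pauli_string_commute_cases[of g p] g(1) p assms(2) by (auto simp: commutator_def)
  have "(g ** p) ** (g ** p) = g ** (p ** g) ** p"
    by (simp add: matrix_mul_assoc)
  also have "p ** g = - (g ** p)" using anti by simp
  also have "g ** - (g ** p) ** p = - ((g ** g) ** (p ** p))"
    by (simp add: matrix_mul_assoc matrix_mul_distribs)
  finally have "(g ** p) ** (g ** p) = - mat 1" by (simp add: gg)
  moreover have "commutator g p = cscale 2 (g ** p)"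
    using anti by (simp add: commutator_def cscale_def vec_eq_iff)
  ultimately have "commutator g p ** commutator g p = cscale (- 4) (mat 1)"
    by (simp add: cscale_mul_left cscale_mul_right cscale_minus)
  moreover have "commutator g p ** commutator g p = cscale (c\<^sup>2) (mat 1)"
    by (simp add: g(3) cscale_mul_left cscale_mul_right gg power2_eq_square)
  ultimately have "cscale (c\<^sup>2) (mat 1 :: 'n op) $ x $ x = cscale (- 4) (mat 1) $ x $ x" for x
    by simp
  then have "c\<^sup>2 = - 4"
    by (simp add: cscale_def mat_def)
  with g p q anti show thesis using that by blast
qed

text \<open>Isolates what the commutator identities use of a component: it consists of Pauli strings
  and no edge leads out of it.\<close>

definition edge_closed :: "'n::finite op set \<Rightarrow> 'n op set \<Rightarrow> bool" where
  "edge_closed \<G> C \<longleftrightarrow> C \<subseteq> pauli_strings \<and> (\<forall>T\<in>C. \<forall>q. commutator_edge \<G> T q \<longrightarrow> q \<in> C)"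

lemma edge_closed_component: "edge_closed \<G> (graph_component \<G> V)"
  unfolding edge_closed_def graph_component_def
proof (intro conjI ballI allI impI; clarify)
  fix T q assume "equivclp (commutator_edge \<G>) V T" and e: "commutator_edge \<G> T q"
  then have "equivclp (commutator_edge \<G>) V q"
    by (meson equivclp_trans r_into_equivclp)
  with e show "q \<in> pauli_strings \<and> equivclp (commutator_edge \<G>) V q"
    by (simp add: commutator_edge_def)
qed

text \<open>
  In the trace pairing, \<open>commutator g\<close> has an antisymmetric coefficient matrix on the span of a
  component, so it annihilates the symmetric tensor \<open>\<Sum>T\<in>C. T \<otimes> T\<close>.
\<close>

lemma sandwich_sum_commutator_pauli:
  fixes g :: "'n::finite op"
  assumes g: "g \<in> \<G>" and \<G>: "\<G> \<subseteq> pauli_strings" and C: "edge_closed \<G> C"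
  shows "sandwich_sum C (commutator g X) = commutator g (sandwich_sum C X)"
proof -
  \<comment> \<open>The coefficient of \<open>commutator g T\<close> along a Pauli string
    \<open>q\<close>; the divisor is the trace of \<open>q ** q\<close>.\<close>
  define a where "a T q = trace (commutator g T ** q) / 2 ^ CARD('n)" for T q
  have antisym: "a T q = - a q T" for T q
    unfolding a_def using trace_commutator[of g T q] trace_mul_sym[of T "commutator g q"] by simp
  have fin: "finite C"
    using C finite_pauli_strings finite_subset unfolding edge_closed_def by blast
  \<comment> \<open>The commutator is zero or a multiple of one neighbour of \<open>T\<close>, which
    lies in \<open>C\<close> by closure, so expanding over \<open>C\<close> loses nothing.\<close>
  have expand: "commutator g T = (\<Sum>q\<in>C. cscale (a T q) q)" if T: "T \<in> C" for T
  proof (cases "g ** T = T ** g")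
    case True
    then have "commutator g T = 0" by (simp add: commutator_def)
    then show ?thesis by (simp add: a_def trace_def)
  next
    case False
    have Tp: "T \<in> pauli_strings" using C T unfolding edge_closed_def by blast
    obtain q c where q: "commutator_edge \<G> T q" "commutator g T = cscale c q"
      using pauli_string_anticommuting_edge[OF g _ Tp False] g \<G> by blast
    then have qC: "q \<in> C" using C T unfolding edge_closed_def by blast
    have "a T r = (if r = q then c else 0)" if "r \<in> C" for r
    proof -
      have "trace (q ** r) = (if q = r then 2 ^ CARD('n) else 0)"
        using that qC C unfolding edge_closed_def by (blast intro: trace_pauli_string_mul)
      then show ?thesis by (auto simp: a_def q(2) cscale_mul_left trace_cscale)
    qed
    then have "(\<Sum>r\<in>C. cscale (a T r) r) = (\<Sum>r\<in>C. if r = q then cscale c q else 0)"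
      by (intro sum.cong) auto
    also have "\<dots> = cscale c q" using qC fin by simp
    finally show ?thesis using q(2) by simp
  qed
  \<comment> \<open>Leibniz rule: the terms in which \<open>g\<close> acts on \<open>X\<close>
    cancel.\<close>
  have "commutator g (sandwich_sum C X) - sandwich_sum C (commutator g X)
      = (\<Sum>T\<in>C. commutator g T ** X ** T + T ** X ** commutator g T)"
    by (simp add: commutator_def sandwich_sum_def matrix_mul.sum_left matrix_mul.sum_right
        matrix_mul_distribs matrix_mul_assoc flip: sum_subtractf sum.distrib)
      (simp add: algebra_simps)
  also have "\<dots> = (\<Sum>T\<in>C. \<Sum>q\<in>C. cscale (a T q) (q ** X ** T))
      + (\<Sum>T\<in>C. \<Sum>q\<in>C. cscale (a T q) (T ** X ** q))"
    by (simp add: expand sum.distrib matrix_mul.sum_left matrix_mul.sum_right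
        cscale_mul_left cscale_mul_right)
  \<comment> \<open>Exchanging the indices makes the second sum the first with transposed
    coefficients; antisymmetry turns it into the negative.\<close>
  also have "(\<Sum>T\<in>C. \<Sum>q\<in>C. cscale (a T q) (T ** X ** q))
      = (\<Sum>T\<in>C. \<Sum>q\<in>C. cscale (a q T) (q ** X ** T))"
    by (rule sum.swap)
  also have "\<dots> = - (\<Sum>T\<in>C. \<Sum>q\<in>C. cscale (a T q) (q ** X ** T))"
  proof -
    have "cscale (a q T) Y = - cscale (a T q) Y" for q T and Y :: "'n op"
      by (subst antisym) (simp add: cscale_def vec_eq_iff)
    then show ?thesis unfolding sum_negf[symmetric] by (intro sum.cong refl)
  qed
  finally show ?thesis by simp
qed

text \<open>Induction over the generated Lie algebra: a property of the generators passes to all of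
  it if the matrices having it form a real Lie algebra.\<close>

lemma dla_subset:
  assumes "is_real_Lie_algebra L" "\<And>p. p \<in> \<G> \<Longrightarrow> cscale \<i> p \<in> L"
  shows "dla \<G> \<subseteq> L"
  unfolding dla_def using assms by (intro hull_minimal) auto

text \<open>The matrices \<open>A\<close> with this property form a real Lie algebra. The generators
  belong to it since the factor \<open>\<i>\<close> passes through the complex-linear
  \<open>sandwich_sum C\<close>.\<close>

lemma sandwich_sum_commutator_dla:
  fixes A :: "'n::finite op"
  assumes \<G>: "\<G> \<subseteq> pauli_strings" and C: "edge_closed \<G> C" and A: "A \<in> dla \<G>"
  shows "sandwich_sum C (commutator A X) = commutator A (sandwich_sum C X)"
proof -
  let ?\<Psi> = "sandwich_sum C"
  let ?L = "{A. \<forall>X. ?\<Psi> (commutator A X) = commutator A (?\<Psi> X)}"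
  note lin = linear_sandwich_sum[of C]
  have "is_real_Lie_algebra ?L"
    unfolding is_real_Lie_algebra_def
  proof (intro conjI ballI)
    have "commutator (A + B) X = commutator A X + commutator B X"
      "commutator (r *\<^sub>R A) X = r *\<^sub>R commutator A X" for A B X :: "'n op" and r
      by (simp_all add: commutator_def matrix_mul_distribs matrix_mul.scaleR_left
          matrix_mul.scaleR_right scaleR_diff_right)
    moreover have "commutator 0 X = 0" for X :: "'n op" by (simp add: commutator_def)
    ultimately show "subspace ?L"
      by (simp add: subspace_def linear_add[OF lin] linear_scale[OF lin] linear_0[OF lin])
  next
    fix A B assume AB: "A \<in> ?L" "B \<in> ?L"
    \<comment> \<open>Bracketing with \<open>commutator A B\<close> is the commutator of the two
      bracket maps, so what commutes with both commutes with it.\<close>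
    have jacobi: "commutator (commutator A B) X
        = commutator A (commutator B X) - commutator B (commutator A X)" for X
      by (simp add: commutator_def matrix_mul_distribs matrix_mul_assoc)
    then show "commutator A B \<in> ?L"
      using AB by (simp add: linear_diff[OF lin])
  qed
  moreover have "cscale \<i> p \<in> ?L" if "p \<in> \<G>" for p
    using sandwich_sum_commutator_pauli[OF that \<G> C]
    by (simp add: commutator_cscale_left sandwich_sum_cscale)
  ultimately have "dla \<G> \<subseteq> ?L" by (rule dla_subset)
  with A show ?thesis by blast
qed

text \<open>Pauli strings are Hermitian, so the generators are anti-Hermitian, and such matrices
  form a real Lie algebra. This makes the group unitary.\<close>

lemma dla_antihermitian:
  fixes A :: "'n::finite op"
  assumes \<G>: "\<G> \<subseteq> pauli_strings" and A: "A \<in> dla \<G>"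
  shows "dagger A = - A"
proof -
  let ?L = "{A :: 'n op. dagger A = - A}"
  note lin = linear_dagger
  have "is_real_Lie_algebra ?L"
    unfolding is_real_Lie_algebra_def
    by (auto simp: subspace_def linear_add[OF lin] linear_scale[OF lin] linear_0[OF lin]
        commutator_def linear_diff[OF lin] dagger_mul matrix_mul_distribs)
  moreover have "cscale \<i> p \<in> ?L" if "p \<in> \<G>" for p
  proof -
    have "dagger p = p" using that \<G> by (blast intro: pauli_string_dagger)
    then have "dagger (cscale \<i> p) = cscale (- \<i>) p" by (simp add: dagger_cscale)
    then show ?thesis by (simp add: cscale_def vec_eq_iff)
  qed
  ultimately have "dla \<G> \<subseteq> ?L" by (rule dla_subset)
  with A show ?thesis by blast
qed

lemma subspace_dla: "subspace (dla \<G>)"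
  unfolding dla_def hull_def is_real_Lie_algebra_def by (rule subspace_Inter) blast

lemma cscale_i_in_dla: "p \<in> \<G> \<Longrightarrow> cscale \<i> p \<in> dla \<G>"
  unfolding dla_def by (intro hull_inc imageI)

text \<open>Moving one \<open>commutator g\<close> across the trace produces a double commutator,
  which multiplies \<open>p\<close> by 4; the sign from antisymmetry matches the square -4 of the
  scalar on the edge. Up to the dimension this trace is a sum of correlators, so \<open>W\<close>
  may move within its component.\<close>

lemma trace_sandwich_sum_edge:
  assumes e: "commutator_edge \<G> p q" and \<G>: "\<G> \<subseteq> pauli_strings" and C: "edge_closed \<G> C"
  shows "trace (q ** sandwich_sum C q) = trace (p ** sandwich_sum C p)"
proof -
  obtain g c where g: "g \<in> \<G>" and anti: "g ** p = - (p ** g)"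
    and gp: "commutator g p = cscale c q" and c: "c\<^sup>2 = - 4"
    using commutator_edgeE[OF e \<G>] by metis
  have gg: "g ** g = mat 1" using g \<G> by (blast intro: pauli_string_square)
  have gpg: "g ** p ** g = - p"
    by (simp add: anti matrix_mul.minus_left) (simp add: gg flip: matrix_mul_assoc)
  have "p ** g ** g = p"
    by (simp add: gg flip: matrix_mul_assoc)
  then have "commutator g (commutator g p) = p - (- p) - ((- p) - p)"
    by (simp only: commutator_def matrix_mul_distribs matrix_mul_assoc gpg gg matrix_mul_lid)
  then have ggp: "commutator g (commutator g p) = cscale 4 p"
    by (simp add: cscale_def vec_eq_iff)
  have "c\<^sup>2 * trace (q ** sandwich_sum C q)
      = trace (commutator g p ** sandwich_sum C (commutator g p))"
    by (simp add: gp sandwich_sum_cscale cscale_mul_left cscale_mul_right trace_cscale power2_eq_square)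
  also have "\<dots> = - trace (commutator g (commutator g p) ** sandwich_sum C p)"
    by (simp add: sandwich_sum_commutator_pauli[OF g \<G> C] trace_commutator)
  also have "\<dots> = c\<^sup>2 * trace (p ** sandwich_sum C p)"
    by (simp add: ggp cscale_mul_left trace_cscale c)
  finally show ?thesis using c by simp
qed

text \<open>Induction along a path; equality along an edge is symmetric, so edges traversed
  backwards are covered too.\<close>

lemma graph_component_invariant:
  assumes "\<And>p q. commutator_edge \<G> p q \<Longrightarrow> f p = f q" and "T \<in> graph_component \<G> V"
  shows "f T = f V"
proof -
  have "equivclp (commutator_edge \<G>) V T"
    using assms(2) by (simp add: graph_component_def)
  then show ?thesis
  proof (induction rule: equivclp_induct)
    case (step y z)
    then show ?case using assms(1) by metis
  qed simp
qed


subsection \<open>Haar averages\<close>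

lemma continuous_on_matrix_mul [continuous_intros]:
  fixes f g :: "'a::topological_space \<Rightarrow> complex^'m::finite^'m"
  shows "continuous_on S f \<Longrightarrow> continuous_on S g \<Longrightarrow> continuous_on S (\<lambda>x. f x ** g x)"
  by (rule matrix_mul.continuous_on)

lemma continuous_on_dagger [continuous_intros]:
  fixes f :: "'a::topological_space \<Rightarrow> complex^'m::finite^'m"
  assumes "continuous_on S f"
  shows "continuous_on S (\<lambda>x. dagger (f x))"
proof -
  have "bounded_linear (dagger :: complex^'m^'m \<Rightarrow> complex^'m^'m)"
    by (simp add: linear_dagger flip: linear_conv_bounded_linear)
  then show ?thesis using assms by (rule bounded_linear.continuous_on)
qed

lemma continuous_on_trace [continuous_intros]:
  fixes f :: "'a::topological_space \<Rightarrow> complex^'m::finite^'m"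
  assumes "continuous_on S f"
  shows "continuous_on S (\<lambda>x. trace (f x))"
proof -
  have "bounded_linear (trace :: complex^'m^'m \<Rightarrow> complex)"
    by (simp add: linear_trace flip: linear_conv_bounded_linear)
  then show ?thesis using assms by (rule bounded_linear.continuous_on)
qed

lemma continuous_otoc_conj: "continuous_on UNIV (\<lambda>U. otoc W (dagger U ** V ** U))"
  unfolding otoc_def by (intro continuous_intros)

text \<open>The columns of \<open>U\<close> are unit vectors, so every entry has modulus at most 1.
  The crude bound serves integrability.\<close>

lemma norm_unitary_le:
  fixes U :: "complex^'m::finite^'m"
  assumes "dagger U ** U = mat 1"
  shows "norm U \<le> real CARD('m) * real CARD('m)"
proof -
  have entry: "norm (U $ i $ j) \<le> 1" for i j
  proof -
    have "(\<Sum>k\<in>UNIV. cnj (U $ k $ j) * U $ k $ j) = (dagger U ** U) $ j $ j"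
      by (simp add: matrix_matrix_mult_def dagger_def)
    also have "\<dots> = 1" by (simp add: assms mat_def)
    finally have "complex_of_real (\<Sum>k\<in>UNIV. (norm (U $ k $ j))\<^sup>2) = 1"
      by (simp add: complex_norm_square mult.commute flip: of_real_power)
    then have "(\<Sum>k\<in>UNIV. (norm (U $ k $ j))\<^sup>2) = 1"
      by (simp only: of_real_eq_1_iff)
    moreover have "(norm (U $ i $ j))\<^sup>2 \<le> (\<Sum>k\<in>UNIV. (norm (U $ k $ j))\<^sup>2)"
      by (rule member_le_sum) auto
    ultimately show ?thesis
      by (simp add: power_le_one_iff)
  qed
  have "norm U \<le> (\<Sum>i\<in>UNIV. norm (U $ i))"
    unfolding norm_vec_def[of U] by (rule L2_set_le_sum) simp
  also have "\<dots> \<le> (\<Sum>i\<in>(UNIV :: 'm set). \<Sum>j\<in>(UNIV :: 'm set). 1)"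
  proof (rule sum_mono)
    fix i
    have "norm (U $ i) \<le> (\<Sum>j\<in>UNIV. norm (U $ i $ j))"
      unfolding norm_vec_def[of "U $ i"] by (rule L2_set_le_sum) simp
    also have "\<dots> \<le> (\<Sum>j\<in>(UNIV :: 'm set). 1)"
      by (rule sum_mono) (rule entry)
    finally show "norm (U $ i) \<le> (\<Sum>j\<in>(UNIV :: 'm set). 1)" .
  qed
  finally show ?thesis by simp
qed

text \<open>
  Left invariance of a probability measure already forces its carrier to be closed under
  multiplication: otherwise \<open>(**) U ` G\<close> is not a measurable set and gets measure 0 instead of 1.
\<close>

lemma haar_prob_measure_mul_closed:
  assumes "haar_prob_measure G \<mu>" "U \<in> G" "U' \<in> G"
  shows "U ** U' \<in> G"
proof -
  have \<mu>: "prob_space \<mu>" "space \<mu> = G" and inv: "\<And>S. S \<in> sets \<mu> \<Longrightarrow> emeasure \<mu> ((**) U ` S) = emeasure \<mu> S"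
    using assms(1,2) unfolding haar_prob_measure_def by auto
  have "emeasure \<mu> ((**) U ` G) = 1"
    using inv[OF sets.top] prob_space.emeasure_space_1[OF \<mu>(1)] \<mu>(2) by simp
  then have "(**) U ` G \<in> sets \<mu>"
    using emeasure_notin_sets[of "(**) U ` G" \<mu>] by auto
  then have "(**) U ` G \<subseteq> G"
    using sets.sets_into_space \<mu>(2) by blast
  then show ?thesis using assms(3) by blast
qed

lemma haar_borel_measurable:
  fixes f :: "complex^'m::finite^'m \<Rightarrow> 'b::topological_space"
  assumes "haar_prob_measure G \<mu>" "continuous_on UNIV f"
  shows "f \<in> borel_measurable \<mu>"
proof -
  have "f \<in> borel_measurable (restrict_space borel G)"
    by (intro measurable_restrict_space1 borel_measurable_continuous_onI assms(2))
  moreover have "sets \<mu> = sets (restrict_space borel G)"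
    using assms(1) by (simp add: haar_prob_measure_def)
  ultimately show ?thesis using measurable_cong_sets by blast
qed

text \<open>Invariance is stated for images, while the distribution of \<open>h ** U\<close> is
  given by preimages; the preimage under \<open>h\<close> is the image under its inverse
  \<open>h'\<close>.\<close>

lemma haar_integral_translate:
  fixes f :: "complex^'m::finite^'m \<Rightarrow> complex"
  assumes \<mu>: "haar_prob_measure G \<mu>" and f: "continuous_on UNIV f"
    and h: "h \<in> G" "h' \<in> G" "h ** h' = mat 1" "h' ** h = mat 1"
  shows "(\<integral>U. f (h ** U) \<partial>\<mu>) = (\<integral>U. f U \<partial>\<mu>)"
proof -
  have sp: "space \<mu> = G" and se: "sets \<mu> = sets (restrict_space borel G)"
    and inv: "\<And>S. S \<in> sets \<mu> \<Longrightarrow> emeasure \<mu> ((**) h' ` S) = emeasure \<mu> S"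
    using \<mu> h(2) unfolding haar_prob_measure_def by auto
  have "(**) h \<in> measurable (restrict_space borel G) (restrict_space borel G)"
    using haar_prob_measure_mul_closed[OF \<mu> h(1)]
    by (intro measurable_restrict_space3 borel_measurable_continuous_onI continuous_intros) auto
  then have meas: "(**) h \<in> measurable \<mu> \<mu>"
    using measurable_cong_sets[OF se se] by blast
  have "distr \<mu> \<mu> ((**) h) = \<mu>"
  proof (rule measure_eqI)
    fix S assume "S \<in> sets (distr \<mu> \<mu> ((**) h))"
    then have S: "S \<in> sets \<mu>" by simp
    then have SG: "S \<subseteq> G" using sets.sets_into_space sp by blast
    have "(**) h -` S \<inter> G = (**) h' ` S"
    proof (intro equalityI subsetI)
      fix U assume "U \<in> (**) h -` S \<inter> G"
      moreover have "U = h' ** (h ** U)" by (simp add: matrix_mul_assoc h)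
      ultimately show "U \<in> (**) h' ` S" by blast
    next
      fix U assume "U \<in> (**) h' ` S"
      then obtain X where X: "X \<in> S" "U = h' ** X" by blast
      then have "h ** U = X" by (simp add: matrix_mul_assoc h)
      moreover have "U \<in> G" using X SG haar_prob_measure_mul_closed[OF \<mu> h(2)] by blast
      ultimately show "U \<in> (**) h -` S \<inter> G" using X by simp
    qed
    then show "emeasure (distr \<mu> \<mu> ((**) h)) S = emeasure \<mu> S"
      using emeasure_distr[OF meas S] inv[OF S] sp by simp
  qed simp
  then show ?thesis
    using integral_distr[OF meas haar_borel_measurable[OF \<mu> f]] by simp
qed

section \<open>Values and sums of the correlator\<close>

lemma otoc_minus: "otoc W (- X) = otoc W X"
  by (simp add: otoc_def linear_neg[OF linear_dagger] matrix_mul_distribs)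

text \<open>Both operators are Hermitian, so the correlator is the normalised trace of the square of
  \<open>W ** T\<close>, which is \<open>mat 1\<close> or \<open>- mat 1\<close> according to the
  sign of commutation.\<close>

lemma otoc_pauli_string:
  fixes W T :: "'n::finite op"
  assumes "W \<in> pauli_strings" "T \<in> pauli_strings"
  shows "otoc W T = (if anticommutator W T = 0 then - 1 else 1)"
proof -
  have sq: "W ** W = mat 1" "T ** T = mat 1" and dg: "dagger W = W" "dagger T = T"
    using assms by (auto intro: pauli_string_square pauli_string_dagger)
  have tr: "trace (mat 1 :: 'n op) = 2 ^ CARD('n)"
    using trace_pauli_string_mul[OF assms(1,1)] sq by simp
  have one: "W ** T ** T ** W = mat 1"
    using sq by (simp flip: matrix_mul_assoc)
  have "otoc W T = 1 / 2 ^ CARD('n) * trace (W ** T ** (W ** T))"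
    by (simp add: otoc_def dg matrix_mul_assoc)
  moreover consider "W ** T = T ** W" | "W ** T = - (T ** W)"
    using pauli_string_commute_cases[OF assms] by blast
  then have "W ** T ** (W ** T) = (if anticommutator W T = 0 then - mat 1 else mat 1)"
  proof cases
    case 1
    have "W ** T ** (W ** T) = mat 1"
      using one by (subst (2) 1) (simp add: matrix_mul_assoc)
    \<comment> \<open>In the commuting case the anticommutator is twice \<open>W ** T\<close>, which
      is invertible and so nonzero.\<close>
    moreover have "anticommutator W T \<noteq> 0"
    proof
      assume "anticommutator W T = 0"
      then have "2 *\<^sub>R (W ** T) = 0"
        using 1 by (simp add: anticommutator_def scaleR_2)
      then have "W ** T ** T ** W = 0" by (simp add: matrix_mul.zero_left)
      with one tr show False by (simp add: trace_def)
    qed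
    ultimately show ?thesis by simp
  next
    case 2
    have "W ** T ** (W ** T) = - mat 1"
      using one by (subst (2) 2) (simp add: matrix_mul_assoc matrix_mul_distribs)
    moreover have "anticommutator W T = 0"
      using 2 by (simp add: anticommutator_def)
    ultimately show ?thesis by simp
  qed
  ultimately show ?thesis
    using tr linear_neg[OF linear_trace, of "mat 1 :: 'n op"] by simp
qed

lemma sum_otoc_pauli:
  assumes "W \<in> pauli_strings" "C \<subseteq> pauli_strings"
  shows "(\<Sum>T\<in>C. otoc W T)
    = of_nat (card C) - 2 * of_nat (card {T \<in> C. anticommutator W T = 0})"
proof -
  have fin: "finite C" using assms(2) finite_pauli_strings finite_subset by blast
  have "(\<Sum>T\<in>C. otoc W T) = (\<Sum>T\<in>C. 1 - 2 * (if anticommutator W T = 0 then 1 else 0))"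
    using assms by (intro sum.cong) (auto simp: otoc_pauli_string)
  also have "\<dots> = of_nat (card C) - 2 * (\<Sum>T\<in>C. if anticommutator W T = 0 then 1 else 0)"
    by (simp add: sum_subtractf sum_distrib_left)
  also have "(\<Sum>T\<in>C. if anticommutator W T = 0 then 1 else 0)
      = (of_nat (card {T \<in> C. anticommutator W T = 0}) :: complex)"
    using fin by (simp flip: sum.inter_filter)
  finally show ?thesis .
qed

text \<open>The conjugation is shifted from \<open>T\<close> to \<open>W\<close>: each trace
  contains \<open>U ** W ** dagger U\<close> between two copies of \<open>T\<close>.\<close>

lemma sum_otoc_conj:
  fixes U W :: "'n::finite op"
  assumes "W \<in> pauli_strings" "C \<subseteq> pauli_strings"
  shows "(\<Sum>T\<in>C. otoc W (dagger U ** T ** U))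
    = 1 / 2 ^ CARD('n) * trace (W ** dagger U ** sandwich_sum C (U ** W ** dagger U) ** U)"
proof -
  have "otoc W (dagger U ** T ** U)
      = 1 / 2 ^ CARD('n) * trace (W ** dagger U ** (T ** (U ** W ** dagger U) ** T) ** U)"
    if "T \<in> C" for T
  proof -
    have "dagger T = T" "dagger W = W"
      using that assms by (auto intro: pauli_string_dagger)
    moreover have "dagger (dagger U) = U" by (simp add: dagger_def vec_eq_iff)
    ultimately show ?thesis
      by (simp add: otoc_def dagger_mul matrix_mul_assoc)
  qed
  then show ?thesis
    by (simp add: sandwich_sum_def matrix_mul.sum_left matrix_mul.sum_right
        linear_sum[OF linear_trace] sum_distrib_left)
qed

text \<open>\<open>sandwich_sum C\<close> commutes with conjugation by \<open>U\<close>, since it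
  commutes with brackets by the Lie algebra. The unitaries then cancel.\<close>

lemma sum_otoc_conj_dla_group:
  fixes W :: "'n::finite op"
  assumes \<G>: "\<G> \<subseteq> pauli_strings" and C: "edge_closed \<G> C" and W: "W \<in> pauli_strings"
    and U: "U \<in> dla_group \<G>"
  shows "(\<Sum>T\<in>C. otoc W (dagger U ** T ** U)) = 1 / 2 ^ CARD('n) * trace (W ** sandwich_sum C W)"
proof -
  obtain A where A: "A \<in> dla \<G>" "U = matrix_exp A"
    using U unfolding dla_group_def by blast
  have dU: "dagger U = matrix_exp (- A)"
    using dagger_matrix_exp[OF dla_antihermitian[OF \<G> A(1)]] A(2) by simp
  have inv: "dagger U ** U = mat 1"
    unfolding dU by (simp add: A(2) matrix_exp_minus_left)
  have "sandwich_sum C (U ** W ** dagger U) = U ** sandwich_sum C W ** dagger U"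
    unfolding dU unfolding A(2)
    by (rule linear_commute_Ad_exp[where \<Psi> = "sandwich_sum C", OF linear_sandwich_sum
          sandwich_sum_commutator_dla[OF \<G> C A(1)]])
  then have "W ** dagger U ** sandwich_sum C (U ** W ** dagger U) ** U
      = W ** (dagger U ** U) ** sandwich_sum C W ** (dagger U ** U)"
    by (simp add: matrix_mul_assoc)
  also have "\<dots> = W ** sandwich_sum C W" by (simp add: inv)
  finally have "W ** dagger U ** sandwich_sum C (U ** W ** dagger U) ** U = W ** sandwich_sum C W" .
  moreover have "C \<subseteq> pauli_strings" using C by (simp add: edge_closed_def)
  ultimately show ?thesis
    using sum_otoc_conj[OF W, of C U] by simp
qed

lemma sum_otoc_pauli_eq_trace:
  fixes W :: "'n::finite op"
  assumes "W \<in> pauli_strings" "C \<subseteq> pauli_strings"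
  shows "(\<Sum>T\<in>C. otoc W T) = 1 / 2 ^ CARD('n) * trace (W ** sandwich_sum C W)"
  using sum_otoc_conj[OF assms, of "mat 1"] by simp

text \<open>With \<open>B = cscale \<i> g\<close> the exponential at angle pi/4 is
  \<open>mat 1 + B\<close> over the square root of 2. As \<open>B\<close> anticommutes with
  \<open>p\<close> and squares to \<open>- mat 1\<close>, conjugation sends \<open>p\<close> to
  \<open>p ** B\<close>, a multiple of \<open>q\<close>.\<close>

lemma dla_group_moves_along_edge:
  fixes p q :: "'n::finite op"
  assumes e: "commutator_edge \<G> p q" and \<G>: "\<G> \<subseteq> pauli_strings"
  obtains A where "A \<in> dla \<G>"
    "dagger (matrix_exp A) ** p ** matrix_exp A = q \<or> dagger (matrix_exp A) ** p ** matrix_exp A = - q"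
proof -
  obtain g c where g: "g \<in> \<G>" and anti: "g ** p = - (p ** g)"
    and gp: "commutator g p = cscale c q" and c: "c\<^sup>2 = - 4"
    using commutator_edgeE[OF e \<G>] by metis
  have gg: "g ** g = mat 1" using g \<G> by (blast intro: pauli_string_square)
  define B where "B = cscale \<i> g"
  define A where "A = (pi / 4) *\<^sub>R B"
  define s :: real where "s = sqrt 2 / 2"
  have ss: "s * (s * 2) = 1" by (simp add: s_def)
  have BB: "B ** B = - mat 1"
    by (simp add: B_def cscale_mul_left cscale_mul_right gg cscale_minus1)
  have AL: "A \<in> dla \<G>"
    unfolding A_def B_def by (intro subspace_scale subspace_dla cscale_i_in_dla g)
  have exp: "matrix_exp A = s *\<^sub>R (mat 1 + B)"
    unfolding A_def matrix_exp_complex_structure[OF BB]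
    by (simp add: cos_45 sin_45 s_def scaleR_add_right)
  have "matrix_exp (- A) = matrix_exp ((- (pi / 4)) *\<^sub>R B)"
    by (simp add: A_def)
  also have "\<dots> = s *\<^sub>R (mat 1 - B)"
    unfolding matrix_exp_complex_structure[OF BB]
    by (simp add: cos_45 sin_45 s_def scaleR_diff_right)
  finally have exp': "dagger (matrix_exp A) = s *\<^sub>R (mat 1 - B)"
    using dagger_matrix_exp[OF dla_antihermitian[OF \<G> AL]] by simp
  have Bp: "B ** p = - (p ** B)"
    by (simp add: B_def cscale_mul_left cscale_mul_right anti cscale_minus)
      (simp add: cscale_def vec_eq_iff)
  have "(mat 1 - B) ** p ** (mat 1 + B) = p + p ** B + p ** B + p ** (B ** B)"
    by (simp add: matrix_mul_distribs matrix_mul_assoc Bp)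
  also have "\<dots> = 2 *\<^sub>R (p ** B)"
    by (simp add: BB matrix_mul_distribs scaleR_2)
  finally have "dagger (matrix_exp A) ** p ** matrix_exp A = p ** B"
    unfolding exp' unfolding exp
    by (simp add: matrix_mul.scaleR_left matrix_mul.scaleR_right ss)
  \<comment> \<open>By anticommutation \<open>commutator g p\<close> is -2 times
    \<open>p ** g\<close>, which fixes the factor.\<close>
  also have "p ** B = cscale (- \<i> / 2) (commutator g p)"
    by (simp add: B_def cscale_mul_right commutator_def anti) (simp add: cscale_def vec_eq_iff)
  also have "\<dots> = cscale (- \<i> / 2 * c) q" by (simp add: gp)
  finally have conj: "dagger (matrix_exp A) ** p ** matrix_exp A = cscale (- \<i> / 2 * c) q" .
  \<comment> \<open>The square is -1/4 times -4, so the scalar is a sign.\<close>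
  have "(- \<i> / 2 * c)\<^sup>2 = (- \<i> / 2)\<^sup>2 * c\<^sup>2" by (rule power_mult_distrib)
  also have "\<dots> = 1" unfolding c by (simp add: power2_eq_square)
  finally have "(- \<i> / 2 * c)\<^sup>2 = 1" .
  then have "- \<i> / 2 * c = 1 \<or> - \<i> / 2 * c = - 1" by (simp only: power2_eq_1_iff)
  then have "dagger (matrix_exp A) ** p ** matrix_exp A = q \<or> dagger (matrix_exp A) ** p ** matrix_exp A = - q"
    unfolding conj
  proof
    assume "- \<i> / 2 * c = 1"
    then have "cscale (- \<i> / 2 * c) q = q" by (simp only: cscale_1)
    then show "cscale (- \<i> / 2 * c) q = q \<or> cscale (- \<i> / 2 * c) q = - q" ..
  next
    assume "- \<i> / 2 * c = - 1"
    then have "cscale (- \<i> / 2 * c) q = - q" by (simp only: cscale_minus1)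
    then show "cscale (- \<i> / 2 * c) q = q \<or> cscale (- \<i> / 2 * c) q = - q" ..
  qed
  with AL show thesis by (rule that)
qed

text \<open>Substituting \<open>?h ** U\<close> for \<open>U\<close> replaces \<open>p\<close> by
  \<open>q\<close> or \<open>- q\<close>, and the correlator ignores the sign.\<close>

lemma haar_integral_otoc_edge:
  assumes \<G>: "\<G> \<subseteq> pauli_strings" and \<mu>: "haar_prob_measure (dla_group \<G>) \<mu>"
    and e: "commutator_edge \<G> p q"
  shows "(\<integral>U. otoc W (dagger U ** p ** U) \<partial>\<mu>) = (\<integral>U. otoc W (dagger U ** q ** U) \<partial>\<mu>)"
proof -
  obtain A where A: "A \<in> dla \<G>" and conj: "dagger (matrix_exp A) ** p ** matrix_exp A = q
      \<or> dagger (matrix_exp A) ** p ** matrix_exp A = - q"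
    by (rule dla_group_moves_along_edge[OF e \<G>])
  let ?h = "matrix_exp A" and ?h' = "matrix_exp (- A)"
  have "- A \<in> dla \<G>" by (intro subspace_neg subspace_dla A)
  from A this have h: "?h \<in> dla_group \<G>" "?h' \<in> dla_group \<G>" "?h ** ?h' = mat 1" "?h' ** ?h = mat 1"
    by (simp_all only: dla_group_def imageI matrix_exp_minus_left matrix_exp_minus_right)
  have "dagger (?h ** U) ** p ** (?h ** U) = dagger U ** (dagger ?h ** p ** ?h) ** U" for U
    by (simp add: dagger_mul matrix_mul_assoc)
  then have "otoc W (dagger (?h ** U) ** p ** (?h ** U)) = otoc W (dagger U ** q ** U)" for U
    using conj by (elim disjE) (simp_all only: matrix_mul_distribs otoc_minus)
  moreover have "(\<integral>U. otoc W (dagger (?h ** U) ** p ** (?h ** U)) \<partial>\<mu>)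
      = (\<integral>U. otoc W (dagger U ** p ** U) \<partial>\<mu>)"
    by (rule haar_integral_translate[OF \<mu> continuous_otoc_conj h])
  ultimately show ?thesis by simp
qed

text \<open>Unitary group elements lie in one closed ball, which is compact; the continuous
  integrand is bounded there, and the measure is finite.\<close>

lemma haar_integrable_otoc:
  fixes V W :: "'n::finite op"
  assumes \<G>: "\<G> \<subseteq> pauli_strings" and \<mu>: "haar_prob_measure (dla_group \<G>) \<mu>"
  shows "integrable \<mu> (\<lambda>U. otoc W (dagger U ** V ** U))"
proof -
  let ?f = "\<lambda>U. otoc W (dagger U ** V ** U)"
  let ?r = "real CARD('n \<Rightarrow> 2) * real CARD('n \<Rightarrow> 2)"
  interpret prob_space \<mu> using \<mu> by (simp add: haar_prob_measure_def)
  have "bounded (?f ` cball 0 ?r)"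
    by (intro compact_imp_bounded compact_continuous_image compact_cball
        continuous_on_subset[OF continuous_otoc_conj] subset_UNIV)
  then obtain b where b: "norm (?f U) \<le> b" if "U \<in> cball 0 ?r" for U
    unfolding bounded_iff by blast
  have "norm (?f U) \<le> b" if "U \<in> space \<mu>" for U
  proof (rule b)
    have "U \<in> dla_group \<G>" using that \<mu> by (simp add: haar_prob_measure_def)
    then obtain A where A: "A \<in> dla \<G>" "U = matrix_exp A"
      unfolding dla_group_def by blast
    have "dagger (matrix_exp A) = matrix_exp (- A)"
      by (intro dagger_matrix_exp dla_antihermitian[OF \<G> A(1)])
    then have "dagger U ** U = mat 1"
      unfolding A(2) by (simp only: matrix_exp_minus_left)
    then show "U \<in> cball 0 ?r" by (simp add: norm_unitary_le)
  qed
  then show ?thesis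
    using haar_borel_measurable[OF \<mu> continuous_otoc_conj] by (intro integrable_const_bound) auto
qed

text \<open>All members of the component have the same average, so the left side is the average of
  their sum, which is constant on the group.\<close>

lemma haar_integral_otoc:
  fixes V W :: "'n::finite op"
  assumes \<G>: "\<G> \<subseteq> pauli_strings" and \<mu>: "haar_prob_measure (dla_group \<G>) \<mu>"
    and V: "V \<in> pauli_strings" and W: "W \<in> pauli_strings"
  shows "of_nat (card (graph_component \<G> V)) * (\<integral>U. otoc W (dagger U ** V ** U) \<partial>\<mu>)
    = (\<Sum>T\<in>graph_component \<G> V. otoc W T)"
proof -
  let ?C = "graph_component \<G> V"
  let ?I = "\<lambda>T. (\<integral>U. otoc W (dagger U ** T ** U) \<partial>\<mu>)"
  interpret prob_space \<mu> using \<mu> by (simp add: haar_prob_measure_def)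
  have sp: "space \<mu> = dla_group \<G>" using \<mu> by (simp add: haar_prob_measure_def)
  have C: "edge_closed \<G> ?C" "?C \<subseteq> pauli_strings"
    using edge_closed_component[of \<G> V] by (auto simp: edge_closed_def)
  have "?I T = ?I V" if "T \<in> ?C" for T
    by (rule graph_component_invariant[where f = ?I, OF _ that]) (rule haar_integral_otoc_edge[OF \<G> \<mu>])
  then have "of_nat (card ?C) * ?I V = (\<Sum>T\<in>?C. ?I T)" by simp
  also have "\<dots> = (\<integral>U. (\<Sum>T\<in>?C. otoc W (dagger U ** T ** U)) \<partial>\<mu>)"
    using haar_integrable_otoc[OF \<G> \<mu>] by (intro Bochner_Integration.integral_sum[symmetric])
  also have "\<dots> = (\<integral>U. (\<Sum>T\<in>?C. otoc W T) \<partial>\<mu>)"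
    by (intro Bochner_Integration.integral_cong refl)
      (simp add: sp sum_otoc_conj_dla_group[OF \<G> C(1) W] sum_otoc_pauli_eq_trace[OF W C(2)])
  also have "\<dots> = (\<Sum>T\<in>?C. otoc W T)" by (simp add: prob_space)
  finally show ?thesis .
qed

text \<open>Double count over pairs from both components: the sum over one component is unchanged
  when the other argument moves within its own.\<close>

lemma sum_otoc_component_swap:
  fixes V W :: "'n::finite op"
  assumes \<G>: "\<G> \<subseteq> pauli_strings" and V: "V \<in> pauli_strings" and W: "W \<in> pauli_strings"
  shows "of_nat (card (graph_component \<G> W)) * (\<Sum>T\<in>graph_component \<G> V. otoc W T)
    = of_nat (card (graph_component \<G> V)) * (\<Sum>T\<in>graph_component \<G> W. otoc V T)"
proof -
  let ?C = "graph_component \<G>"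
  have const: "(\<Sum>T\<in>?C P. otoc R T) = (\<Sum>T\<in>?C P. otoc Q T)"
    if R: "R \<in> ?C Q" and Q: "Q \<in> pauli_strings" for P Q R
  proof -
    have "trace (R ** sandwich_sum (?C P) R) = trace (Q ** sandwich_sum (?C P) Q)"
      by (rule graph_component_invariant[OF _ R])
        (rule trace_sandwich_sum_edge[OF _ \<G> edge_closed_component, symmetric])
    moreover have "?C P \<subseteq> pauli_strings" "R \<in> pauli_strings"
      using R by (auto simp: graph_component_def)
    ultimately show ?thesis using Q by (simp add: sum_otoc_pauli_eq_trace)
  qed
  \<comment> \<open>On Pauli strings the correlator depends only on whether the anticommutator
    vanishes, a symmetric condition.\<close>
  have sym: "otoc R T = otoc T R" if "R \<in> ?C W" "T \<in> ?C V" for R T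
    using that by (simp add: graph_component_def otoc_pauli_string anticommutator_def add.commute)
  have "of_nat (card (?C W)) * (\<Sum>T\<in>?C V. otoc W T) = (\<Sum>R\<in>?C W. \<Sum>T\<in>?C V. otoc R T)"
    using const[OF _ W] by simp
  also have "\<dots> = (\<Sum>T\<in>?C V. \<Sum>R\<in>?C W. otoc R T)" by (rule sum.swap)
  also have "\<dots> = (\<Sum>T\<in>?C V. \<Sum>R\<in>?C W. otoc T R)"
    using sym by (intro sum.cong refl)
  also have "\<dots> = of_nat (card (?C V)) * (\<Sum>R\<in>?C W. otoc V R)"
    using const[OF _ V] by simp
  finally show ?thesis .
qed

theorem corollary3:
  fixes \<G> :: "'n::finite op set" and V W :: "'n op" and \<mu> :: "'n op measure"
  assumes "\<G> \<subseteq> pauli_strings"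
    and "haar_prob_measure (dla_group \<G>) \<mu>"
    and "V \<in> pauli_strings" and "W \<in> pauli_strings"
  shows "(\<integral>U. otoc W (dagger U ** V ** U) \<partial>\<mu>)
           = 1 - 2 * of_nat (card {T \<in> graph_component \<G> V. anticommutator W T = 0})
                 / of_nat (card (graph_component \<G> V))
       \<and> (\<integral>U. otoc W (dagger U ** V ** U) \<partial>\<mu>)
           = 1 - 2 * of_nat (card {T \<in> graph_component \<G> W. anticommutator V T = 0})
                 / of_nat (card (graph_component \<G> W))"
proof -
  let ?C = "graph_component \<G>"
  let ?I = "\<integral>U. otoc W (dagger U ** V ** U) \<partial>\<mu>"
  have card: "(of_nat (card (?C P)) :: complex) \<noteq> 0" if "P \<in> pauli_strings" for P
  proof -
    have "P \<in> ?C P" using that by (simp add: graph_component_def)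
    moreover have "finite (?C P)"
      by (rule finite_subset[OF _ finite_pauli_strings]) (auto simp: graph_component_def)
    ultimately show ?thesis by auto
  qed
  have sub: "?C P \<subseteq> pauli_strings" for P by (auto simp: graph_component_def)
  have I: "of_nat (card (?C V)) * ?I = (\<Sum>T\<in>?C V. otoc W T)"
    by (rule haar_integral_otoc[OF assms])
  \<comment> \<open>Multiplying by the size of \<open>?C V\<close> makes \<open>I\<close>
    applicable; this nonzero factor is cancelled afterwards.\<close>
  have "of_nat (card (?C V)) * (of_nat (card (?C W)) * ?I)
      = of_nat (card (?C W)) * (of_nat (card (?C V)) * ?I)"
    by (rule mult.left_commute)
  also have "\<dots> = of_nat (card (?C V)) * (\<Sum>T\<in>?C W. otoc V T)"
    unfolding I by (rule sum_otoc_component_swap[OF assms(1,3,4)])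
  finally have I': "of_nat (card (?C W)) * ?I = (\<Sum>T\<in>?C W. otoc V T)"
    using card[OF assms(3)] by simp
  \<comment> \<open>Here \<open>a\<close> is the size of a component and \<open>b\<close> twice the
    number of anticommuting strings in it.\<close>
  have solve: "x = 1 - b / a" if "a * x = a - b" "a \<noteq> 0" for a b x :: complex
    using that by (simp add: field_simps)
  show ?thesis
    using solve[OF I[unfolded sum_otoc_pauli[OF assms(4) sub]] card[OF assms(3)]]
      solve[OF I'[unfolded sum_otoc_pauli[OF assms(3) sub]] card[OF assms(4)]]
    by (rule conjI)
qed

end
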